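(* Let $G=(V,E)$ be a finite graph. Let $Z_1,\ldots,Z_m$ be independent random variables, let $W_i\subseteq V$ be given for each $i=1,\ldots,m$, and for every $v\in V$ let $X_v$ be a random variable with values in a measurable space $(A,\mathcal{A})$ that is a measurable function of those $Z_i$ for which $v\in W_i$. Let $\delta$ and $\Delta$ be uncertainty functions over $A$ and $A\times A$, respectively, such that $\Delta-\delta\circ\pi_1$ and $\Delta-\delta\circ\pi_2$ are both concave, where $\pi_1(\mu),\pi_2(\mu)$ denote the marginals of a probability measure $\mu$ on $A\times A$. Then $$\sum_{e\in E}\Delta(X_e)\ \ge\ \beta\sum_{v\in V}\delta(X_v),\qquad\text{where}\quad \beta=\min_{1\le i\le m;\ W\subseteq W_i}\frac{|\overline{W}|}{|W|}.$$
   Context: Let $\mathcal{M}$ be the space of probability measures on a measurable space. A function $\delta:\mathcal{M}\to\mathbb{R}$ is an uncertainty function if it is concave and $\delta(\nu)=0$ for any $\nu$ concentrated on one point (unit mass). Concavity means that the value at a mixture distribution is at least the expectation of the values: if $\omega\mapsto\nu_\omega\in\mathcal{M}$ is a measurable family indexed by a probability space $(\Omega,P)$ (i.e. $\omega\mapsto\nu_\omega(B)$ is measurable for every measurable $B$), then $\delta(\int\nu_\omega\,dP(\omega))\ge\int\delta(\nu_\omega)\,dP(\omega)$; the same meaning of concavity applies to $\Delta$ and to $\Delta-\delta\circ\pi_1$, $\Delta-\delta\circ\pi_2$. The functions $\delta$ and $\Delta$ are assumed measurable (with respect to the $\sigma$-algebra on $\mathcal{M}$ generated by the evaluations $\nu\mapsto\nu(B)$)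 so that these expectations make sense. An uncertainty function over $A$ (resp. $A\times A$) is one on the probability measures on $(A,\mathcal{A})$ (resp. on $A\times A$ with the product $\sigma$-algebra). $\delta(X_v)$ is $\delta$ applied to the distribution of $X_v$; for an edge $e=(u,v)$ (with an arbitrary fixed ordering of its endpoints) $\Delta(X_e)$ is $\Delta$ applied to the joint distribution of $(X_u,X_v)$. $\overline{W}=\{e\in E:\ e\cap W\neq\emptyset\}$ is the set of edges incident to $W$. The minimum is over pairs $(i,W)$ with $W$ a nonempty subset of $W_i$; at least one $W_i$ is nonempty. *)

theory Defs
  imports "HOL-Probability.Probability"
begin

definition finite_simple_graph :: "'v set \<Rightarrow> 'v set set \<Rightarrow> bool" where
  "finite_simple_graph V E \<longleftrightarrow>
     finite V \<and> E \<subseteq> {{u, v} | u v. u \<in> V \<and> v \<in> V \<and> u \<noteq> v}"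

definition incident_edges :: "'v set set \<Rightarrow> 'v set \<Rightarrow> 'v set set" where
  "incident_edges E U = {e \<in> E. e \<inter> U \<noteq> {}}"

definition seed_expansion :: "'v set set \<Rightarrow> nat \<Rightarrow> (nat \<Rightarrow> 'v set) \<Rightarrow> real" where
  "seed_expansion E m W =
     Min {real (card (incident_edges E U)) / real (card U) | i U.
            i \<in> {1..m} \<and> U \<subseteq> W i \<and> U \<noteq> {}}"

text \<open>
  The space of probability measures on \<open>A\<close>, with the sigma-algebra generated by the
  evaluations, is \<open>prob_algebra A\<close>; the mixture of the measurable family \<open>\<nu>\<close> over
  \<open>(\<Omega>, P)\<close> is \<open>P \<bind> \<nu>\<close>.  A definition cannot quantify over the type of the index
  space \<open>\<Omega>\<close>, so it is fixed here; lemma \<open>mixture_concaveD\<close> below recovers the inequality for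
  index spaces of any type.

  The inequality is required whenever the expectation is finite.  For measurable \<open>f\<close>
  vanishing at unit masses this already forces \<open>f\<close> to be nonnegative and the expectation to be
  finite for every family (\<open>uncertainty_function_nonneg\<close>,
  \<open>uncertainty_function_integrable\<close>), hence also for the differences of such functions
  (\<open>uncertainty_difference_integrable\<close>), so no family is left out by the proviso.
\<close>

definition mixture_concave :: "'a measure \<Rightarrow> ('a measure \<Rightarrow> real) \<Rightarrow> bool" where
  "mixture_concave A f \<longleftrightarrow>
     (\<forall>(P :: 'a measure measure) \<nu>.
        prob_space P \<longrightarrow> \<nu> \<in> P \<rightarrow>\<^sub>M prob_algebra A \<longrightarrow> integrable P (\<lambda>\<omega>. f (\<nu> \<omega>)) \<longrightarrow>
        (\<integral>\<omega>. f (\<nu> \<omega>) \<partial>P) \<le> f (P \<bind> \<nu>))"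

definition uncertainty_function :: "'a measure \<Rightarrow> ('a measure \<Rightarrow> real) \<Rightarrow> bool" where
  "uncertainty_function A \<delta> \<longleftrightarrow>
     \<delta> \<in> borel_measurable (prob_algebra A) \<and>
     mixture_concave A \<delta> \<and>
     (\<forall>x\<in>space A. \<delta> (return A x) = 0)"

lemma mixture_concaveD:
  fixes P :: "'w measure"
  assumes f: "mixture_concave A f" and meas: "f \<in> borel_measurable (prob_algebra A)"
    and P: "prob_space P" and N: "\<nu> \<in> P \<rightarrow>\<^sub>M prob_algebra A"
    and int: "integrable P (\<lambda>\<omega>. f (\<nu> \<omega>))"
  shows "(\<integral>\<omega>. f (\<nu> \<omega>) \<partial>P) \<le> f (P \<bind> \<nu>)"
proof -
  interpret P: prob_space P by fact
  let ?P = "distr P (prob_algebra A) \<nu>"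
  have "prob_space ?P" using N by (rule P.prob_space_distr)
  moreover have "integrable ?P (\<lambda>\<mu>. f \<mu>)"
    using int by (subst integrable_distr_eq[OF N meas])
  ultimately have "(\<integral>\<mu>. f \<mu> \<partial>?P) \<le> f (?P \<bind> (\<lambda>\<mu>. \<mu>))"
    using f unfolding mixture_concave_def by auto
  moreover have "(\<integral>\<mu>. f \<mu> \<partial>?P) = (\<integral>\<omega>. f (\<nu> \<omega>) \<partial>P)"
    by (rule integral_distr[OF N meas])
  moreover have "?P \<bind> (\<lambda>\<mu>. \<mu>) = P \<bind> \<nu>"
    by (rule bind_distr[OF N _ P.not_empty, of _ A]) (auto intro: measurable_prob_algebraD)
  ultimately show ?thesis by simp
qed

lemma uncertainty_function_nonneg:
  assumes d: "uncertainty_function A \<delta>" and mu: "\<mu> \<in> space (prob_algebra A)"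
  shows "0 \<le> \<delta> \<mu>"
proof -
  have mp: "prob_space \<mu>" and ms: "sets \<mu> = sets A"
    using mu by (auto simp: space_prob_algebra)
  have sp: "space \<mu> = space A" using ms by (rule sets_eq_imp_space_eq)
  have z: "\<delta> (return A x) = 0" if "x \<in> space \<mu>" for x
    using d that sp by (auto simp: uncertainty_function_def)
  have r: "return A \<in> \<mu> \<rightarrow>\<^sub>M prob_algebra A"
    by (subst measurable_cong_sets[OF ms refl]) (rule measurable_return_prob_space)
  have "integrable \<mu> (\<lambda>x. \<delta> (return A x))"
    using z by (subst Bochner_Integration.integrable_cong[OF refl, where g="\<lambda>_. 0"]) auto
  then have "(\<integral>x. \<delta> (return A x) \<partial>\<mu>) \<le> \<delta> (\<mu> \<bind> return A)"
    using d mp r by (intro mixture_concaveD) (auto simp: uncertainty_function_def)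
  moreover have "(\<integral>x. \<delta> (return A x) \<partial>\<mu>) = 0"
    using z by (subst Bochner_Integration.integral_cong[OF refl, where g="\<lambda>_. 0"]) auto
  moreover have "\<mu> \<bind> return A = \<mu>" by (rule bind_return'') (rule ms)
  ultimately show ?thesis by simp
qed

lemma uncertainty_function_integrable:
  fixes P :: "'w measure"
  assumes d: "uncertainty_function A \<delta>"
    and P: "prob_space P" and N: "\<nu> \<in> P \<rightarrow>\<^sub>M prob_algebra A"
  shows "integrable P (\<lambda>\<omega>. \<delta> (\<nu> \<omega>))"
proof -
  interpret P: prob_space P by fact
  have dm[measurable]: "\<delta> \<in> borel_measurable (prob_algebra A)"
    using d by (simp add: uncertainty_function_def)
  note N[measurable]
  have N'[measurable]: "\<nu> \<in> P \<rightarrow>\<^sub>M subprob_algebra A" using N by (rule measurable_prob_algebraD)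
  define g where "g = (\<lambda>\<omega>. \<delta> (\<nu> \<omega>))"
  have gm[measurable]: "g \<in> borel_measurable P" unfolding g_def by measurable
  have g0: "0 \<le> g \<omega>" if "\<omega> \<in> space P" for \<omega>
    unfolding g_def using d measurable_space[OF N that] by (rule uncertainty_function_nonneg)
  \<comment> \<open>Where \<open>g > n\<close>, refine the family to unit masses; the mixture is unchanged.\<close>
  have bound: "(\<integral>\<omega>. g \<omega> * indicator {\<omega>. g \<omega> \<le> real n} \<omega> \<partial>P) \<le> \<delta> (P \<bind> \<nu>)" for n
  proof -
    define R where "R = P \<bind> (\<lambda>\<omega>. \<nu> \<omega> \<bind> (\<lambda>x. return (P \<Otimes>\<^sub>M A) (\<omega>, x)))"
    define K where "K = (\<lambda>(\<omega>, x). if g \<omega> \<le> real n then \<nu> \<omega> else return A x)"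
    have k[measurable]: "K \<in> P \<Otimes>\<^sub>M A \<rightarrow>\<^sub>M prob_algebra A"
      unfolding K_def split_beta by measurable
    have k'[measurable]: "K \<in> P \<Otimes>\<^sub>M A \<rightarrow>\<^sub>M subprob_algebra A"
      using k by (rule measurable_prob_algebraD)
    have inner: "(\<lambda>\<omega>. \<nu> \<omega> \<bind> (\<lambda>x. return (P \<Otimes>\<^sub>M A) (\<omega>, x))) \<in> P \<rightarrow>\<^sub>M prob_algebra (P \<Otimes>\<^sub>M A)"
      by measurable
    have inner': "(\<lambda>\<omega>. \<nu> \<omega> \<bind> (\<lambda>x. return (P \<Otimes>\<^sub>M A) (\<omega>, x))) \<in> P \<rightarrow>\<^sub>M subprob_algebra (P \<Otimes>\<^sub>M A)"
      using inner by (rule measurable_prob_algebraD)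
    have Pin: "P \<in> space (prob_algebra P)" using P by (simp add: space_prob_algebra)
    have Rin: "R \<in> space (prob_algebra (P \<Otimes>\<^sub>M A))"
      unfolding R_def using prob_space_bind'[OF Pin inner] sets_bind'[OF Pin inner] by (simp add: space_prob_algebra)
    have Rp: "prob_space R" and Rs[measurable_cong]: "sets R = sets (P \<Otimes>\<^sub>M A)"
      using Rin by (auto simp: space_prob_algebra)
    have sR: "space R = space P \<times> space A"
      using sets_eq_imp_space_eq[OF Rs] by (simp add: space_pair_measure)
    have s\<nu>: "sets (\<nu> \<omega>) = sets A" "space (\<nu> \<omega>) = space A" "prob_space (\<nu> \<omega>)"
      if "\<omega> \<in> space P" for \<omega>
      using measurable_space[OF N that] by (auto simp: space_prob_algebra dest: sets_eq_imp_space_eq)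
    have row: "(\<lambda>x. return (P \<Otimes>\<^sub>M A) (\<omega>, x)) \<in> \<nu> \<omega> \<rightarrow>\<^sub>M subprob_algebra (P \<Otimes>\<^sub>M A)"
      if w: "\<omega> \<in> space P" for \<omega>
    proof -
      have "(\<lambda>x. return (P \<Otimes>\<^sub>M A) (\<omega>, x)) \<in> A \<rightarrow>\<^sub>M subprob_algebra (P \<Otimes>\<^sub>M A)"
        using w by measurable
      then show ?thesis by (subst measurable_cong_sets[OF s\<nu>(1)[OF w] refl])
    qed
    have dK: "\<delta> (K z) = g (fst z) * indicator {\<omega>. g \<omega> \<le> real n} (fst z)" if "z \<in> space R" for z
      using that d sR by (auto simp: K_def g_def uncertainty_function_def split: prod.splits)
    have gmR: "(\<lambda>z. g (fst z) * indicator {\<omega>. g \<omega> \<le> real n} (fst z)) \<in> borel_measurable (P \<Otimes>\<^sub>M A)"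
      unfolding indicator_def by measurable
    interpret R: prob_space R by fact
    have intR: "integrable R (\<lambda>z. g (fst z) * indicator {\<omega>. g \<omega> \<le> real n} (fst z))"
      using gmR g0 sR
      by (intro R.integrable_const_bound[where B="real n"])
        (auto simp: indicator_def measurable_cong_sets[OF Rs refl])
    have intK: "integrable R (\<lambda>z. \<delta> (K z))"
      using intR by (subst Bochner_Integration.integrable_cong[OF refl dK])
    have kR: "K \<in> R \<rightarrow>\<^sub>M prob_algebra A" by (subst measurable_cong_sets[OF Rs refl]) (rule k)
    have "(\<integral>z. \<delta> (K z) \<partial>R) \<le> \<delta> (R \<bind> K)"
      using d Rp kR intK by (intro mixture_concaveD) (auto simp: uncertainty_function_def)
    moreover have "R \<bind> K = P \<bind> \<nu>"
    proof -
      have "R \<bind> K = P \<bind> (\<lambda>\<omega>. (\<nu> \<omega> \<bind> (\<lambda>x. return (P \<Otimes>\<^sub>M A) (\<omega>, x))) \<bind> K)"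
        unfolding R_def by (rule bind_assoc[OF inner' k'])
      also have "\<dots> = P \<bind> \<nu>"
      proof (rule bind_cong[OF refl])
        fix \<omega> assume w: "\<omega> \<in> space P"
        have "(\<nu> \<omega> \<bind> (\<lambda>x. return (P \<Otimes>\<^sub>M A) (\<omega>, x))) \<bind> K =
              \<nu> \<omega> \<bind> (\<lambda>x. return (P \<Otimes>\<^sub>M A) (\<omega>, x) \<bind> K)"
          by (rule bind_assoc[OF row[OF w] k'])
        also have "\<dots> = \<nu> \<omega> \<bind> (\<lambda>x. K (\<omega>, x))"
          using w s\<nu>[OF w] by (intro bind_cong refl bind_return[OF k']) (auto simp: space_pair_measure)
        also have "\<dots> = \<nu> \<omega>"
        proof (cases "g \<omega> \<le> real n")
          case True
          then show ?thesis
            using w s\<nu>[OF w] by (simp add: K_def bind_const' prob_space_imp_subprob_space)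
        next
          case False
          then show ?thesis using s\<nu>[OF w] by (simp add: K_def bind_return'')
        qed
        finally show "(\<nu> \<omega> \<bind> (\<lambda>x. return (P \<Otimes>\<^sub>M A) (\<omega>, x))) \<bind> K = \<nu> \<omega>" .
      qed
      finally show ?thesis .
    qed
    moreover have "(\<integral>z. \<delta> (K z) \<partial>R) = (\<integral>\<omega>. g \<omega> * indicator {\<omega>. g \<omega> \<le> real n} \<omega> \<partial>P)"
    proof -
      have fstR: "fst \<in> R \<rightarrow>\<^sub>M P" by (subst measurable_cong_sets[OF Rs refl]) (rule measurable_fst)
      have "distr R P fst = P \<bind> (\<lambda>\<omega>. return P \<omega>)"
      proof -
        have "distr R P fst = P \<bind> (\<lambda>\<omega>. distr (\<nu> \<omega> \<bind> (\<lambda>x. return (P \<Otimes>\<^sub>M A) (\<omega>, x))) P fst)"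
          unfolding R_def by (rule distr_bind[OF inner' P.not_empty measurable_fst])
        also have "\<dots> = P \<bind> (\<lambda>\<omega>. return P \<omega>)"
        proof (rule bind_cong[OF refl])
          fix \<omega> assume w: "\<omega> \<in> space P"
          interpret v: prob_space "\<nu> \<omega>" using s\<nu>[OF w] by simp
          have "distr (\<nu> \<omega> \<bind> (\<lambda>x. return (P \<Otimes>\<^sub>M A) (\<omega>, x))) P fst =
                \<nu> \<omega> \<bind> (\<lambda>x. distr (return (P \<Otimes>\<^sub>M A) (\<omega>, x)) P fst)"
            by (rule distr_bind[OF row[OF w] v.not_empty measurable_fst])
          also have "\<dots> = \<nu> \<omega> \<bind> (\<lambda>x. return P \<omega>)"
            using w s\<nu>[OF w]
            by (intro bind_cong refl) (subst distr_return[OF measurable_fst], auto simp: space_pair_measure)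
          also have "\<dots> = return P \<omega>"
            using w v.prob_space_axioms
            by (intro bind_const') (auto intro!: prob_space_imp_subprob_space prob_space_return)
          finally show "distr (\<nu> \<omega> \<bind> (\<lambda>x. return (P \<Otimes>\<^sub>M A) (\<omega>, x))) P fst = return P \<omega>" .
        qed
        finally show ?thesis .
      qed
      also have "\<dots> = P" by (rule bind_return'') simp
      finally have dR: "distr R P fst = P" .
      have "(\<integral>z. \<delta> (K z) \<partial>R) = (\<integral>z. g (fst z) * indicator {\<omega>. g \<omega> \<le> real n} (fst z) \<partial>R)"
        by (rule Bochner_Integration.integral_cong[OF refl dK])
      also have "\<dots> = (\<integral>\<omega>. g \<omega> * indicator {\<omega>. g \<omega> \<le> real n} \<omega> \<partial>distr R P fst)"
        by (rule integral_distr[OF fstR, symmetric]) (unfold indicator_def, measurable)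
      finally show ?thesis using dR by simp
    qed
    ultimately show ?thesis by simp
  qed
  define h where "h = (\<lambda>(n::nat) \<omega>. g \<omega> * indicator {\<omega>. g \<omega> \<le> real n} \<omega>)"
  have hm: "h n \<in> borel_measurable P" for n unfolding h_def indicator_def by measurable
  have hint: "integrable P (h n)" for n
    using g0 by (intro P.integrable_const_bound[where B="real n"] hm) (auto simp: h_def indicator_def)
  have lim: "(\<lambda>n. ennreal (h n \<omega>)) \<longlonglongrightarrow> ennreal (g \<omega>)" for \<omega>
  proof (rule tendsto_eventually)
    show "\<forall>\<^sub>F n in sequentially. ennreal (h n \<omega>) = ennreal (g \<omega>)"
      using eventually_ge_at_top[of "nat \<lceil>g \<omega>\<rceil>"]
      by eventually_elim (auto simp: h_def indicator_def nat_ceiling_le_eq)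
  qed
  have "(\<integral>\<^sup>+\<omega>. ennreal (g \<omega>) \<partial>P) = (\<integral>\<^sup>+\<omega>. liminf (\<lambda>n. ennreal (h n \<omega>)) \<partial>P)"
    using lim by (intro nn_integral_cong) (auto intro!: lim_imp_Liminf[symmetric])
  also have "\<dots> \<le> liminf (\<lambda>n. \<integral>\<^sup>+\<omega>. ennreal (h n \<omega>) \<partial>P)"
    using hm by (intro nn_integral_liminf) measurable
  also have "\<dots> \<le> liminf (\<lambda>n::nat. ennreal (\<delta> (P \<bind> \<nu>)))"
  proof (rule Liminf_mono, rule always_eventually, rule allI)
    fix n
    have "(\<integral>\<^sup>+\<omega>. ennreal (h n \<omega>) \<partial>P) = ennreal (\<integral>\<omega>. h n \<omega> \<partial>P)"
      using hint g0 by (intro nn_integral_eq_integral) (auto simp: h_def intro!: AE_I2)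
    then show "(\<integral>\<^sup>+\<omega>. ennreal (h n \<omega>) \<partial>P) \<le> ennreal (\<delta> (P \<bind> \<nu>))"
      using bound[of n] by (simp add: h_def ennreal_leI)
  qed
  also have "\<dots> = ennreal (\<delta> (P \<bind> \<nu>))" by (simp add: Liminf_const)
  also have "\<dots> < \<infinity>" by simp
  finally have "(\<integral>\<^sup>+\<omega>. ennreal (g \<omega>) \<partial>P) < \<infinity>" .
  then have "integrable P g"
    using g0 gm by (intro integrableI_nonneg) (auto intro!: AE_I2)
  then show ?thesis by (simp add: g_def)
qed

lemma uncertainty_difference_integrable:
  fixes P :: "'w measure"
  assumes \<delta>: "uncertainty_function A \<delta>" and \<Delta>: "uncertainty_function B \<Delta>"
    and \<pi>: "\<pi> \<in> B \<rightarrow>\<^sub>M A"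
    and P: "prob_space P" and N: "\<nu> \<in> P \<rightarrow>\<^sub>M prob_algebra B"
  shows "integrable P (\<lambda>\<omega>. \<Delta> (\<nu> \<omega>) - \<delta> (distr (\<nu> \<omega>) A \<pi>))"
  using uncertainty_function_integrable[OF \<Delta> P N]
    uncertainty_function_integrable[OF \<delta> P
      measurable_compose[OF N measurable_distr_prob_space[OF \<pi>]]]
  by (rule Bochner_Integration.integrable_diff)

end

theory Submission
  imports Defs
begin

text \<open>
  The sources \<open>Z\<^sub>1, \<dots>, Z\<^sub>m\<close> are revealed one after the other.  Let \<open>\<delta>\<^sub>k(v)\<close> be the
  expectation of \<open>\<delta>\<close> at the conditional law of \<open>X\<^sub>v\<close> given \<open>Z\<^sub>1, \<dots>, Z\<^sub>k\<close>, and \<open>\<Delta>\<^sub>k(e)\<close> the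
  same quantity for \<open>\<Delta>\<close> and the pair \<open>X\<^sub>e\<close>.  For \<open>k = 0\<close> these are the uncertainties in the
  theorem; for \<open>k = m\<close> they vanish, because the conditional laws are unit masses.  So it is
  enough to compare, for each \<open>k\<close>, the drop of \<open>\<Delta>\<close> over all edges with the drop of \<open>\<delta>\<close> over
  all vertices when \<open>Z\<^sub>k\<close> is revealed.

  The conditional law given less information is a mixture of the conditional laws given more
  (\<open>bind_cond_law\<close>), so for a concave \<open>f\<close> the expected value of \<open>f\<close> decreases as information
  grows (\<open>cond_value_antimono\<close>).  For \<open>\<delta>\<close> and \<open>\<Delta>\<close> this makes all drops nonnegative; for
  \<open>\<Delta> - \<delta> \<circ> \<pi>\<close> it says that the drop at an edge is at least the drop at each of its endpoints
  (\<open>cond_value_drop_mono\<close>).  Moreover the drop at \<open>v\<close> is zero unless \<open>v \<in> W\<^sub>k\<close>, since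
  otherwise \<open>X\<^sub>v\<close> ignores \<open>Z\<^sub>k\<close> (\<open>cond_value_irrelevant\<close>).

  What remains is about graphs: if \<open>w \<ge> 0\<close> is supported on \<open>W\<^sub>k\<close>, then each superlevel set
  \<open>U = {v. w v > t}\<close> with \<open>t \<ge> 0\<close> meets at least \<open>\<beta> |U|\<close> edges, and integrating over \<open>t\<close> gives
  \<open>\<Sum>\<^sub>e max\<^sub>v\<^sub>\<in>\<^sub>e w(v) \<ge> \<beta> \<Sum>\<^sub>v w(v)\<close> (\<open>expansion_weighted\<close>).

  Conditioning is made explicit by transporting everything to the product of the laws of the
  \<open>Z\<^sub>i\<close>: the conditional law of \<open>T\<close> given the coordinates in \<open>J\<close> is the law of \<open>T\<close> after all
  other coordinates have been drawn afresh.
\<close>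

section \<open>Weighted expansion\<close>

text \<open>
  A discrete layer-cake argument.  Let \<open>U\<close> be the support of \<open>w\<close> and \<open>c\<close> the least value of
  \<open>w\<close> on it.  Removing the bottom layer, of height \<open>c\<close>, lowers the left-hand side by
  \<open>\<beta> c |U|\<close> and allows \<open>F\<close> to be lowered by \<open>c\<close> on every edge meeting \<open>U\<close>, which is at
  least as much in total.  The support has then become smaller.
\<close>

lemma expansion_weighted:
  fixes w :: "'v \<Rightarrow> real" and F :: "'v set \<Rightarrow> real" and \<beta> :: real
  assumes "finite V" "finite E"
    and exp: "\<And>U. U \<subseteq> S \<Longrightarrow> U \<noteq> {} \<Longrightarrow> \<beta> * card U \<le> card (incident_edges E U)"
    and w0: "\<And>v. v \<in> V \<Longrightarrow> 0 \<le> w v" and wS: "\<And>v. v \<in> V - S \<Longrightarrow> w v = 0"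
    and F0: "\<And>e. e \<in> E \<Longrightarrow> 0 \<le> F e"
    and Fw: "\<And>e v. e \<in> E \<Longrightarrow> v \<in> e \<Longrightarrow> v \<in> V \<Longrightarrow> w v \<le> F e"
  shows "\<beta> * (\<Sum>v\<in>V. w v) \<le> (\<Sum>e\<in>E. F e)"
  using w0 wS F0 Fw
proof (induction "card {v \<in> V. 0 < w v}" arbitrary: w F rule: less_induct)
  case less
  define U where "U = {v \<in> V. 0 < w v}"
  have finU: "finite U" and UV: "U \<subseteq> V" and US: "U \<subseteq> S"
    using \<open>finite V\<close> less.prems(2) by (force simp: U_def)+
  have w_out: "w v = 0" if "v \<in> V - U" for v
    using that less.prems(1)[of v] by (auto simp: U_def)
  show ?case
  proof (cases "U = {}")
    case True
    then show ?thesis using w_out less.prems(3) by (simp add: sum_nonneg)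
  next
    case False
    define c where "c = Min (w ` U)"
    have c_le: "c \<le> w v" if "v \<in> U" for v using that finU by (simp add: c_def)
    have "c \<in> w ` U" unfolding c_def using finU False by (intro Min_in) auto
    then obtain u where u: "u \<in> U" "w u = c" by auto
    have c0: "0 < c" using u by (auto simp: U_def)
    define w' where "w' = (\<lambda>v. if v \<in> U then w v - c else w v)"
    define F' where "F' = (\<lambda>e. if e \<inter> U \<noteq> {} then F e - c else F e)"
    \<comment> \<open>The minimizer \<open>u\<close> leaves the support.\<close>
    have "card {v \<in> V. 0 < w' v} < card U"
    proof (rule psubset_card_mono[OF finU])
      have "{v \<in> V. 0 < w' v} \<subseteq> U - {u}"
        using w_out u by (fastforce simp: w'_def split: if_splits)
      then show "{v \<in> V. 0 < w' v} \<subset> U" using u by blast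
    qed
    then have IH: "\<beta> * sum w' V \<le> sum F' E"
      unfolding U_def
    proof (rule less.hyps)
      fix v assume "v \<in> V"
      then show "0 \<le> w' v" using c_le less.prems(1) by (simp add: w'_def)
    next
      fix v assume "v \<in> V - S"
      then show "w' v = 0" using less.prems(2) US by (auto simp: w'_def)
    next
      fix e assume e: "e \<in> E"
      show F'0: "0 \<le> F' e"
      proof (cases "e \<inter> U = {}")
        case True
        then show ?thesis using less.prems(3)[OF e] by (simp add: F'_def)
      next
        case False
        then obtain v where v: "v \<in> e" "v \<in> U" by blast
        then show ?thesis
          using less.prems(4)[OF e, of v] c_le[of v] UV by (auto simp: F'_def)
      qed
      fix v assume v: "v \<in> e" "v \<in> V"
      show "w' v \<le> F' e"
      proof (cases "v \<in> U")
        case True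
        then have "e \<inter> U \<noteq> {}" using v by blast
        then show ?thesis using True less.prems(4)[OF e v] by (simp add: w'_def F'_def)
      next
        case False
        then show ?thesis using F'0 w_out[of v] v by (simp add: w'_def)
      qed
    qed
    have sw: "sum w' V = sum w V - c * card U"
    proof -
      have "sum w' V = (\<Sum>v\<in>V. w v - (if v \<in> U then c else 0))"
        by (intro sum.cong) (auto simp: w'_def)
      also have "\<dots> = sum w V - (\<Sum>v\<in>V. if v \<in> U then c else 0)" by (rule sum_subtractf)
      also have "(\<Sum>v\<in>V. if v \<in> U then c else 0) = c * card U"
        using \<open>finite V\<close> UV by (simp add: sum.If_cases Int_absorb1)
      finally show ?thesis .
    qed
    have sF: "sum F' E = sum F E - c * card (incident_edges E U)"
    proof -
      have "sum F' E = (\<Sum>e\<in>E. F e - (if e \<in> incident_edges E U then c else 0))"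
        by (intro sum.cong) (auto simp: F'_def incident_edges_def)
      also have "\<dots> = sum F E - (\<Sum>e\<in>E. if e \<in> incident_edges E U then c else 0)"
        by (rule sum_subtractf)
      also have "(\<Sum>e\<in>E. if e \<in> incident_edges E U then c else 0) = c * card (incident_edges E U)"
      proof -
        have "E \<inter> incident_edges E U = incident_edges E U" by (auto simp: incident_edges_def)
        then show ?thesis using \<open>finite E\<close> by (simp add: sum.If_cases)
      qed
      finally show ?thesis .
    qed
    have "c * (\<beta> * card U) \<le> c * card (incident_edges E U)"
      using exp[OF US False] c0 by simp
    then show ?thesis using IH by (simp add: sw sF algebra_simps)
  qed
qed

lemma seed_expansion_le:
  assumes "\<And>i. i \<in> {1..m} \<Longrightarrow> finite (W i)" and i: "i \<in> {1..m}" and U: "U \<subseteq> W i" "U \<noteq> {}"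
  shows "seed_expansion E m W * card U \<le> card (incident_edges E U)"
proof -
  let ?R = "{real (card (incident_edges E U)) / real (card U) | i U.
              i \<in> {1..m} \<and> U \<subseteq> W i \<and> U \<noteq> {}}"
  have "?R \<subseteq> (\<lambda>U. real (card (incident_edges E U)) / real (card U)) ` (\<Union>i\<in>{1..m}. Pow (W i))"
    by blast
  then have "finite ?R" by (rule finite_subset) (use assms(1) in auto)
  then have "seed_expansion E m W \<le> card (incident_edges E U) / card U"
    unfolding seed_expansion_def using i U by (intro Min_le) auto
  moreover have "0 < card U" using assms(1)[OF i] U by (simp add: card_gt_0_iff finite_subset)
  ultimately show ?thesis by (simp add: field_simps)
qed

lemma sum_eq_sum_of_drops:
  fixes g :: "'x \<Rightarrow> nat \<Rightarrow> real"
  assumes "\<And>x. x \<in> B \<Longrightarrow> g x m = 0"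
  shows "(\<Sum>x\<in>B. g x 0) = (\<Sum>k<m. \<Sum>x\<in>B. g x k - g x (Suc k))"
  using assms by (subst sum.swap) (simp add: sum_lessThan_telescope')

section \<open>Conditional laws on a finite product space\<close>

text \<open>
  With \<open>z'\<close> random, this is the configuration \<open>z\<close> with its coordinates outside \<open>J\<close> drawn
  afresh.
\<close>

definition resample :: "'i set \<Rightarrow> 'i set \<Rightarrow> ('i \<Rightarrow> 'z) \<Rightarrow> ('i \<Rightarrow> 'z) \<Rightarrow> 'i \<Rightarrow> 'z" where
  "resample I J z z' = (\<lambda>i\<in>I. if i \<in> J then z i else z' i)"

text \<open>
  When \<open>J \<subseteq> K\<close>, redrawing outside \<open>J\<close> and then outside \<open>K\<close> amounts to one redrawing outside
  \<open>J\<close>, with new values that are themselves a resampled configuration.  This is what turns a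
  two-stage conditioning into a single one.
\<close>

lemma resample_resample:
  "J \<subseteq> K \<Longrightarrow> resample I K (resample I J z z') z'' = resample I J z (resample I K z' z'')"
  by (auto simp: resample_def fun_eq_iff)

lemma measurable_resample[measurable]:
  "(\<lambda>(z, z'). resample I J z z') \<in> Pi\<^sub>M I M \<Otimes>\<^sub>M Pi\<^sub>M I M \<rightarrow>\<^sub>M Pi\<^sub>M I M"
  unfolding resample_def split_beta
proof (rule measurable_restrict)
  fix i assume i: "i \<in> I"
  have "(\<lambda>x. fst x i) \<in> Pi\<^sub>M I M \<Otimes>\<^sub>M Pi\<^sub>M I M \<rightarrow>\<^sub>M M i"
    "(\<lambda>x. snd x i) \<in> Pi\<^sub>M I M \<Otimes>\<^sub>M Pi\<^sub>M I M \<rightarrow>\<^sub>M M i"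
    using i by (auto intro: measurable_compose[OF measurable_fst measurable_component_singleton]
      measurable_compose[OF measurable_snd measurable_component_singleton])
  then show "(\<lambda>x. if i \<in> J then fst x i else snd x i) \<in> Pi\<^sub>M I M \<Otimes>\<^sub>M Pi\<^sub>M I M \<rightarrow>\<^sub>M M i"
    by (cases "i \<in> J") auto
qed

text \<open>
  A regular conditional law of \<open>T\<close> given the coordinates in \<open>J\<close>, defined at every \<open>z\<close> and
  not only almost everywhere; it is one because the coordinates are independent under \<open>P\<close>.
\<close>

definition cond_law :: "('i \<Rightarrow> 'z) measure \<Rightarrow> 'i set \<Rightarrow> 'b measure \<Rightarrow> (('i \<Rightarrow> 'z) \<Rightarrow> 'b) \<Rightarrow>
    'i set \<Rightarrow> ('i \<Rightarrow> 'z) \<Rightarrow> 'b measure" where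
  "cond_law P I B T J z = distr P B (\<lambda>z'. T (resample I J z z'))"

definition cond_value :: "('i \<Rightarrow> 'z) measure \<Rightarrow> 'i set \<Rightarrow> 'b measure \<Rightarrow> ('b measure \<Rightarrow> real) \<Rightarrow>
    (('i \<Rightarrow> 'z) \<Rightarrow> 'b) \<Rightarrow> 'i set \<Rightarrow> real" where
  "cond_value P I B f T J = (\<integral>z. f (cond_law P I B T J z) \<partial>P)"

context finite_product_prob_space
begin

abbreviation P :: "('a \<Rightarrow> 'b) measure" where "P \<equiv> Pi\<^sub>M I M"

abbreviation law where "law \<equiv> cond_law P I"
abbreviation val where "val \<equiv> cond_value P I"

lemma P_sigma_finite: "sigma_finite_measure P"
  by (rule prob_space_imp_sigma_finite[OF P.prob_space_axioms])

text \<open>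
  Assembling the coordinates in \<open>J\<close> of one sample and the remaining coordinates of an
  independent second sample gives a sample again: both laws agree on boxes.
\<close>

lemma distr_resample: "distr (P \<Otimes>\<^sub>M P) P (\<lambda>(z, z'). resample I J z z') = P"
proof (rule PiM_eqI[OF finite_index])
  interpret PP: pair_prob_space P P ..
  fix A assume A: "\<And>i. i \<in> I \<Longrightarrow> A i \<in> sets (M i)"
  define B where "B = (\<lambda>i. if i \<in> J then A i else space (M i))"
  define C where "C = (\<lambda>i. if i \<in> J then space (M i) else A i)"
  have B: "\<And>i. i \<in> I \<Longrightarrow> B i \<in> sets (M i)" and C: "\<And>i. i \<in> I \<Longrightarrow> C i \<in> sets (M i)"
    using A by (auto simp: B_def C_def)
  have sp: "A i \<subseteq> space (M i)" if "i \<in> I" for i using A[OF that] by (rule sets.sets_into_space)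
  have "(\<lambda>(z, z'). resample I J z z') -` Pi\<^sub>E I A \<inter> space (P \<Otimes>\<^sub>M P) = Pi\<^sub>E I B \<times> Pi\<^sub>E I C"
    using sp by (auto simp: resample_def space_pair_measure space_PiM B_def C_def PiE_iff extensional_def
        split: if_splits) (blast | fastforce)+
  then have "emeasure (distr (P \<Otimes>\<^sub>M P) P (\<lambda>(z, z'). resample I J z z')) (Pi\<^sub>E I A)
      = emeasure (P \<Otimes>\<^sub>M P) (Pi\<^sub>E I B \<times> Pi\<^sub>E I C)"
    using A finite_index by (subst emeasure_distr) (auto intro!: sets_PiM_I_finite)
  also have "\<dots> = emeasure P (Pi\<^sub>E I B) * emeasure P (Pi\<^sub>E I C)"
    using B C finite_index by (intro sigma_finite_measure.emeasure_pair_measure_Times[OF P_sigma_finite] sets_PiM_I_finite) auto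
  also have "\<dots> = (\<Prod>i\<in>I. emeasure (M i) (B i) * emeasure (M i) (C i))"
    using B C by (simp add: measure_times prod.distrib)
  also have "\<dots> = (\<Prod>i\<in>I. emeasure (M i) (A i))"
    by (intro prod.cong refl) (auto simp: B_def C_def M.emeasure_space_1)
  finally show "emeasure (distr (P \<Otimes>\<^sub>M P) P (\<lambda>(z, z'). resample I J z z')) (Pi\<^sub>E I A)
      = (\<Prod>i\<in>I. emeasure (M i) (A i))" .
qed simp

lemma measurable_comp_resample:
  assumes [measurable]: "T \<in> P \<rightarrow>\<^sub>M B"
  shows "(\<lambda>(z, z'). T (resample I J z z')) \<in> P \<Otimes>\<^sub>M P \<rightarrow>\<^sub>M B"
proof -
  have "(\<lambda>x. T ((\<lambda>(z, z'). resample I J z z') x)) \<in> P \<Otimes>\<^sub>M P \<rightarrow>\<^sub>M B" by measurable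
  then show ?thesis by (simp add: split_beta')
qed

lemma measurable_resample_section:
  assumes T: "T \<in> P \<rightarrow>\<^sub>M B" and z: "z \<in> space P"
  shows "(\<lambda>z'. T (resample I J z z')) \<in> P \<rightarrow>\<^sub>M B"
  using measurable_Pair2[OF measurable_comp_resample[OF T] z] by simp

lemma measurable_cond_law:
  assumes T: "T \<in> P \<rightarrow>\<^sub>M B"
  shows "law B T J \<in> P \<rightarrow>\<^sub>M prob_algebra B"
proof -
  have "(\<lambda>_. P) \<in> P \<rightarrow>\<^sub>M prob_algebra P"
    by (intro measurable_const) (simp add: space_prob_algebra P.prob_space_axioms)
  then show ?thesis
    unfolding cond_law_def[abs_def]
    by (rule measurable_distr_prob_space2) (rule measurable_comp_resample[OF T])
qed

text \<open>
  The tower property: after redrawing the coordinates outside \<open>J\<close>, the conditional laws given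
  \<open>K \<supseteq> J\<close> mix to the conditional law given \<open>J\<close>.  The mixture is the law of \<open>T\<close> at a double
  resampling, which \<open>resample_resample\<close> and \<open>distr_resample\<close> reduce to a single one.
\<close>

lemma bind_cond_law:
  assumes T: "T \<in> P \<rightarrow>\<^sub>M B" and JK: "J \<subseteq> K" and z: "z \<in> space P"
  shows "P \<bind> (\<lambda>z'. law B T K (resample I J z z')) = law B T J z"
proof -
  interpret PP: pair_prob_space P P ..
  have rs: "(\<lambda>z'. resample I J z z') \<in> P \<rightarrow>\<^sub>M P"
    using measurable_Pair2[OF measurable_resample z] by simp
  have k: "(\<lambda>z'. law B T K (resample I J z z')) \<in> P \<rightarrow>\<^sub>M prob_algebra B"
    by (rule measurable_compose[OF rs measurable_cond_law[OF T]])
  have Pin: "P \<in> space (prob_algebra P)" by (simp add: space_prob_algebra P.prob_space_axioms)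
  define H where "H = (\<lambda>(z', z''). T (resample I J z (resample I K z' z'')))"
  have TJ: "(\<lambda>\<zeta>. T (resample I J z \<zeta>)) \<in> P \<rightarrow>\<^sub>M B" by (rule measurable_resample_section[OF T z])
  have H: "H \<in> P \<Otimes>\<^sub>M P \<rightarrow>\<^sub>M B"
    using measurable_compose[OF measurable_resample TJ] by (simp add: H_def split_beta')
  have "P \<bind> (\<lambda>z'. law B T K (resample I J z z')) = distr (P \<Otimes>\<^sub>M P) B H"
  proof (rule measure_eqI)
    show "sets (P \<bind> (\<lambda>z'. law B T K (resample I J z z'))) = sets (distr (P \<Otimes>\<^sub>M P) B H)"
      using sets_bind'[OF Pin k] by simp
    fix Y assume "Y \<in> sets (P \<bind> (\<lambda>z'. law B T K (resample I J z z')))"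
    then have Y: "Y \<in> sets B" using sets_bind'[OF Pin k] by simp
    have "emeasure (P \<bind> (\<lambda>z'. law B T K (resample I J z z'))) Y
        = (\<integral>\<^sup>+z'. emeasure (law B T K (resample I J z z')) Y \<partial>P)"
      by (rule emeasure_bind_prob_algebra[OF Pin k Y])
    also have "\<dots> = (\<integral>\<^sup>+z'. emeasure P (Pair z' -` (H -` Y \<inter> space (P \<Otimes>\<^sub>M P))) \<partial>P)"
    proof (rule nn_integral_cong)
      fix z' assume z': "z' \<in> space P"
      have "emeasure (law B T K (resample I J z z')) Y
          = emeasure P ((\<lambda>z''. T (resample I K (resample I J z z') z'')) -` Y \<inter> space P)"
        unfolding cond_law_def
        by (rule emeasure_distr[OF measurable_resample_section[OF T measurable_space[OF rs z']] Y])
      also have "(\<lambda>z''. T (resample I K (resample I J z z') z'')) -` Y \<inter> space P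
          = Pair z' -` (H -` Y \<inter> space (P \<Otimes>\<^sub>M P))"
        using z' by (auto simp: H_def resample_resample[OF JK] space_pair_measure)
      finally show "emeasure (law B T K (resample I J z z')) Y
          = emeasure P (Pair z' -` (H -` Y \<inter> space (P \<Otimes>\<^sub>M P)))" .
    qed
    also have "\<dots> = emeasure (P \<Otimes>\<^sub>M P) (H -` Y \<inter> space (P \<Otimes>\<^sub>M P))"
      by (rule sigma_finite_measure.emeasure_pair_measure_alt[OF P_sigma_finite, symmetric])
        (rule measurable_sets[OF H Y])
    also have "\<dots> = emeasure (distr (P \<Otimes>\<^sub>M P) B H) Y" by (rule emeasure_distr[OF H Y, symmetric])
    finally show "emeasure (P \<bind> (\<lambda>z'. law B T K (resample I J z z'))) Y
        = emeasure (distr (P \<Otimes>\<^sub>M P) B H) Y" .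
  qed
  also have "\<dots> = distr (distr (P \<Otimes>\<^sub>M P) P (\<lambda>(z, z'). resample I K z z')) B (\<lambda>\<zeta>. T (resample I J z \<zeta>))"
    by (subst distr_distr[OF TJ measurable_resample]) (simp add: H_def comp_def split_beta')
  finally show ?thesis by (simp add: distr_resample cond_law_def)
qed

text \<open>
  For each \<open>z\<close>, concavity applied to the mixture in \<open>bind_cond_law\<close> compares \<open>f\<close> at the law
  given \<open>J\<close> with the average of \<open>f\<close> over the laws given \<open>K\<close>.  By Fubini and
  \<open>distr_resample\<close>, averaging this average over \<open>z\<close> yields the expectation on \<open>P\<close>.
\<close>

lemma cond_value_antimono:
  assumes T: "T \<in> P \<rightarrow>\<^sub>M B" and JK: "J \<subseteq> K"
    and f: "mixture_concave B f" and fm: "f \<in> borel_measurable (prob_algebra B)"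
    and int: "\<And>L. integrable P (\<lambda>z. f (law B T L z))"
  shows "val B f T K \<le> val B f T J"
proof -
  interpret PP: pair_prob_space P P ..
  define g where "g = (\<lambda>z. f (law B T K z))"
  have gm: "g \<in> borel_measurable P"
    unfolding g_def by (rule measurable_compose[OF measurable_cond_law[OF T] fm])
  define h where "h = (\<lambda>(z, z'). g (resample I J z z'))"
  have g_int: "integrable (distr (P \<Otimes>\<^sub>M P) P (\<lambda>(z, z'). resample I J z z')) g"
    using int[of K] by (simp add: distr_resample g_def)
  have h_int: "integrable (P \<Otimes>\<^sub>M P) h"
    using g_int unfolding integrable_distr_eq[OF measurable_resample gm]
    by (simp add: h_def split_beta')
  have "val B f T K = integral\<^sup>L (distr (P \<Otimes>\<^sub>M P) P (\<lambda>(z, z'). resample I J z z')) g"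
    by (simp add: distr_resample g_def cond_value_def)
  also have "\<dots> = integral\<^sup>L (P \<Otimes>\<^sub>M P) h"
    by (subst integral_distr[OF measurable_resample gm]) (simp add: h_def split_beta')
  also have "\<dots> = (\<integral>z. (\<integral>z'. h (z, z') \<partial>P) \<partial>P)" by (rule PP.integral_fst'[OF h_int, symmetric])
  also have "\<dots> \<le> (\<integral>z. f (law B T J z) \<partial>P)"
  proof (rule integral_mono_AE[OF PP.integrable_fst'[OF h_int] int])
    show "AE z in P. (\<integral>z'. h (z, z') \<partial>P) \<le> f (law B T J z)"
      using PP.AE_integrable_fst'[OF h_int] AE_space
    proof eventually_elim
      fix z assume hz: "integrable P (\<lambda>z'. h (z, z'))" and z: "z \<in> space P"
      have rs: "(\<lambda>z'. resample I J z z') \<in> P \<rightarrow>\<^sub>M P"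
        using measurable_Pair2[OF measurable_resample z] by simp
      have "(\<integral>z'. f (law B T K (resample I J z z')) \<partial>P)
          \<le> f (P \<bind> (\<lambda>z'. law B T K (resample I J z z')))"
        using hz by (intro mixture_concaveD[OF f fm P.prob_space_axioms
            measurable_compose[OF rs measurable_cond_law[OF T]]]) (simp add: h_def g_def)
      then show "(\<integral>z'. h (z, z') \<partial>P) \<le> f (law B T J z)"
        by (simp add: h_def g_def bind_cond_law[OF T JK z])
    qed
  qed
  finally show ?thesis by (simp add: cond_value_def)
qed

lemma cond_value_empty:
  "val B f T {} = f (distr P B T)"
proof -
  have "law B T {} z = distr P B T" for z
    unfolding cond_law_def
    by (intro distr_cong refl arg_cong[where f=T])
      (auto simp: resample_def space_PiM PiE_def extensional_restrict)
  then show ?thesis by (simp add: cond_value_def P.prob_space)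
qed

lemma cond_value_all:
  assumes T: "T \<in> P \<rightarrow>\<^sub>M B" and f: "uncertainty_function B f"
  shows "val B f T I = 0"
proof -
  have "f (law B T I z) = 0" if z: "z \<in> space P" for z
  proof -
    have "resample I I z z' = z" for z'
      using z by (auto simp: resample_def space_PiM PiE_iff extensional_def fun_eq_iff)
    then have "law B T I z = return B (T z)"
      using measurable_space[OF T z] by (simp add: cond_law_def P.distr_const)
    then show ?thesis using f measurable_space[OF T z] by (simp add: uncertainty_function_def)
  qed
  then show ?thesis
    unfolding cond_value_def by (subst Bochner_Integration.integral_cong[OF refl, where g="\<lambda>_. 0"]) auto
qed

lemma cond_value_irrelevant:
  assumes "\<And>z z'. (\<And>j. j \<in> I - {i} \<Longrightarrow> z j = z' j) \<Longrightarrow> T z = T z'"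
  shows "val B f T (insert i J) = val B f T J"
proof -
  have "T (resample I (insert i J) z z') = T (resample I J z z')" for z z'
    by (rule assms) (auto simp: resample_def)
  then show ?thesis by (simp add: cond_value_def cond_law_def)
qed

lemma distr_cond_law:
  assumes T: "T \<in> P \<rightarrow>\<^sub>M B" and q: "q \<in> B \<rightarrow>\<^sub>M C" and z: "z \<in> space P"
  shows "distr (law B T J z) C q = law C (\<lambda>z. q (T z)) J z"
  unfolding cond_law_def
  by (subst distr_distr[OF q measurable_resample_section[OF T z]]) (simp add: comp_def)

lemma uncertainty_cond_law_integrable:
  assumes T: "T \<in> P \<rightarrow>\<^sub>M B" and f: "uncertainty_function B f"
  shows "integrable P (\<lambda>z. f (law B T L z))"
  by (rule uncertainty_function_integrable[OF f P.prob_space_axioms measurable_cond_law[OF T]])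

lemma uncertainty_cond_value_antimono:
  assumes T: "T \<in> P \<rightarrow>\<^sub>M B" and "J \<subseteq> K" and f: "uncertainty_function B f"
  shows "val B f T K \<le> val B f T J"
  using f by (intro cond_value_antimono[OF assms(1,2)] uncertainty_cond_law_integrable[OF T f])
    (auto simp: uncertainty_function_def)

text \<open>
  This is \<open>cond_value_antimono\<close> for the concave function in the last hypothesis, whose
  expected value splits because the image under \<open>q\<close> of the conditional law of \<open>T\<close> is the
  conditional law of \<open>q \<circ> T\<close>.
\<close>

lemma cond_value_drop_mono:
  assumes T: "T \<in> P \<rightarrow>\<^sub>M B" and q: "q \<in> B \<rightarrow>\<^sub>M C" and JK: "J \<subseteq> K"
    and \<Delta>: "uncertainty_function B \<Delta>" and \<delta>: "uncertainty_function C \<delta>"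
    and concave: "mixture_concave B (\<lambda>\<mu>. \<Delta> \<mu> - \<delta> (distr \<mu> C q))"
  shows "val C \<delta> (\<lambda>z. q (T z)) J - val C \<delta> (\<lambda>z. q (T z)) K \<le> val B \<Delta> T J - val B \<Delta> T K"
proof -
  have qT: "(\<lambda>z. q (T z)) \<in> P \<rightarrow>\<^sub>M C" by (rule measurable_compose[OF T q])
  have split: "val B (\<lambda>\<mu>. \<Delta> \<mu> - \<delta> (distr \<mu> C q)) T L = val B \<Delta> T L - val C \<delta> (\<lambda>z. q (T z)) L" for L
  proof -
    have "val B (\<lambda>\<mu>. \<Delta> \<mu> - \<delta> (distr \<mu> C q)) T L
        = (\<integral>z. \<Delta> (law B T L z) - \<delta> (law C (\<lambda>z. q (T z)) L z) \<partial>P)"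
      unfolding cond_value_def
      by (intro Bochner_Integration.integral_cong refl) (simp add: distr_cond_law[OF T q])
    also have "\<dots> = val B \<Delta> T L - val C \<delta> (\<lambda>z. q (T z)) L"
      unfolding cond_value_def
      by (intro Bochner_Integration.integral_diff uncertainty_cond_law_integrable[OF T \<Delta>]
          uncertainty_cond_law_integrable[OF qT \<delta>])
    finally show ?thesis .
  qed
  have m: "(\<lambda>\<mu>. \<Delta> \<mu> - \<delta> (distr \<mu> C q)) \<in> borel_measurable (prob_algebra B)"
    using \<Delta> \<delta> measurable_compose[OF measurable_distr_prob_space[OF q], of \<delta> borel]
    by (intro borel_measurable_diff) (auto simp: uncertainty_function_def)
  have "val B (\<lambda>\<mu>. \<Delta> \<mu> - \<delta> (distr \<mu> C q)) T K \<le> val B (\<lambda>\<mu>. \<Delta> \<mu> - \<delta> (distr \<mu> C q)) T J"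
    by (intro cond_value_antimono[OF T JK concave m]
        uncertainty_difference_integrable[OF \<delta> \<Delta> q P.prob_space_axioms measurable_cond_law[OF T]])
  then show ?thesis by (simp add: split)
qed

end

section \<open>Exposing the sources one at a time\<close>

theorem theorem4p3:
  fixes V :: "'v set" and E :: "'v set set" and ends :: "'v set \<Rightarrow> 'v \<times> 'v"
    and M :: "'w measure"
    and m :: nat and S :: "nat \<Rightarrow> 'z measure" and Z :: "nat \<Rightarrow> 'w \<Rightarrow> 'z"
    and W :: "nat \<Rightarrow> 'v set"
    and A :: "'a measure" and X :: "'v \<Rightarrow> 'w \<Rightarrow> 'a"
    and \<delta> :: "'a measure \<Rightarrow> real" and \<Delta> :: "('a \<times> 'a) measure \<Rightarrow> real"
  assumes graph: "finite_simple_graph V E"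
    and ends: "\<And>e. e \<in> E \<Longrightarrow> e = {fst (ends e), snd (ends e)}"
    and M: "prob_space M"
    and Z: "prob_space.indep_vars M S Z {1..m}"
    and W: "\<And>i. i \<in> {1..m} \<Longrightarrow> W i \<subseteq> V"
    and W_nonempty: "\<exists>i\<in>{1..m}. W i \<noteq> {}"
    and X: "\<And>v. v \<in> V \<Longrightarrow>
      \<exists>f \<in> (\<Pi>\<^sub>M i\<in>{i \<in> {1..m}. v \<in> W i}. S i) \<rightarrow>\<^sub>M A.
        \<forall>\<omega>\<in>space M. X v \<omega> = f (\<lambda>i\<in>{i \<in> {1..m}. v \<in> W i}. Z i \<omega>)"
    and \<delta>: "uncertainty_function A \<delta>"
    and \<Delta>: "uncertainty_function (A \<Otimes>\<^sub>M A) \<Delta>"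
    and concave1: "mixture_concave (A \<Otimes>\<^sub>M A) (\<lambda>\<mu>. \<Delta> \<mu> - \<delta> (distr \<mu> A fst))"
    and concave2: "mixture_concave (A \<Otimes>\<^sub>M A) (\<lambda>\<mu>. \<Delta> \<mu> - \<delta> (distr \<mu> A snd))"
  shows "(\<Sum>e\<in>E. \<Delta> (distr M (A \<Otimes>\<^sub>M A) (\<lambda>\<omega>. (X (fst (ends e)) \<omega>, X (snd (ends e)) \<omega>))))
           \<ge> seed_expansion E m W * (\<Sum>v\<in>V. \<delta> (distr M A (X v)))"
proof -
  interpret M: prob_space M by (rule M)
  define I where "I = {1..m}"
  have I_ne: "I \<noteq> {}" and finI: "finite I" using W_nonempty by (auto simp: I_def)
  have finV: "finite V" and E_sub: "E \<subseteq> Pow V"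
    using graph by (auto simp: finite_simple_graph_def)
  have finE: "finite E" using finite_subset[OF E_sub] finV by simp
  have endsV: "fst (ends e) \<in> V" "snd (ends e) \<in> V" if "e \<in> E" for e
    using ends[OF that] E_sub that by auto
  have Zm: "Z i \<in> M \<rightarrow>\<^sub>M S i" if "i \<in> I" for i
    using Z that unfolding M.indep_vars_def by (auto simp: I_def)
  \<comment> \<open>The product locale wants a probability measure at every index; outside \<open>I\<close> any will do.\<close>
  define N where
    "N i = (if i \<in> I then distr M (S i) (Z i) else return (count_space UNIV) undefined)" for i
  have N_prob: "prob_space (N i)" for i
    unfolding N_def by (auto intro!: M.prob_space_distr Zm prob_space_return)
  interpret Q: finite_product_prob_space N I
    by (intro finite_product_prob_space.intro product_prob_space.intro
        product_prob_space_axioms.intro product_sigma_finite.intro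
        finite_product_sigma_finite.intro finite_product_sigma_finite_axioms.intro
        prob_space_imp_sigma_finite N_prob finI)
  let ?P = "Pi\<^sub>M I N"
  have sets_P: "sets ?P = sets (Pi\<^sub>M I S)" by (intro sets_PiM_cong) (auto simp: N_def)
  define Zs where "Zs = (\<lambda>\<omega>. \<lambda>i\<in>I. Z i \<omega>)"
  have Zs: "Zs \<in> M \<rightarrow>\<^sub>M Pi\<^sub>M I S" unfolding Zs_def by (intro measurable_restrict Zm)
  have Zs': "Zs \<in> M \<rightarrow>\<^sub>M ?P" using Zs by (simp add: measurable_cong_sets[OF refl sets_P])
  have distr_Zs: "distr M ?P Zs = ?P"
  proof -
    have "distr M ?P Zs = distr M (Pi\<^sub>M I S) Zs" by (rule distr_cong) (simp_all add: sets_P)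
    also have "\<dots> = (\<Pi>\<^sub>M i\<in>I. distr M (S i) (Z i))"
      using Z M.indep_vars_iff_distr_eq_PiM'[OF I_ne Zm] unfolding Zs_def by (simp add: I_def)
    also have "\<dots> = ?P" by (intro PiM_cong) (auto simp: N_def)
    finally show ?thesis .
  qed
  have "\<exists>f. \<forall>v\<in>V. f v \<in> (\<Pi>\<^sub>M i\<in>{i \<in> I. v \<in> W i}. S i) \<rightarrow>\<^sub>M A \<and>
      (\<forall>\<omega>\<in>space M. X v \<omega> = f v (\<lambda>i\<in>{i \<in> I. v \<in> W i}. Z i \<omega>))"
  proof (rule bchoice, rule ballI)
    fix v assume "v \<in> V"
    from X[OF this, folded I_def] show "\<exists>g. g \<in> (\<Pi>\<^sub>M i\<in>{i \<in> I. v \<in> W i}. S i) \<rightarrow>\<^sub>M A \<and>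
        (\<forall>\<omega>\<in>space M. X v \<omega> = g (\<lambda>i\<in>{i \<in> I. v \<in> W i}. Z i \<omega>))"
      unfolding Bex_def .
  qed
  then obtain f where f_all: "\<forall>v\<in>V. f v \<in> (\<Pi>\<^sub>M i\<in>{i \<in> I. v \<in> W i}. S i) \<rightarrow>\<^sub>M A \<and>
      (\<forall>\<omega>\<in>space M. X v \<omega> = f v (\<lambda>i\<in>{i \<in> I. v \<in> W i}. Z i \<omega>))" by (rule exE)
  have f: "f v \<in> (\<Pi>\<^sub>M i\<in>{i \<in> I. v \<in> W i}. S i) \<rightarrow>\<^sub>M A" if "v \<in> V" for v
    by (rule bspec[OF f_all that, THEN conjunct1])
  have Xf: "X v \<omega> = f v (\<lambda>i\<in>{i \<in> I. v \<in> W i}. Z i \<omega>)" if "v \<in> V" "\<omega> \<in> space M" for v \<omega>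
    by (rule bspec[OF bspec[OF f_all that(1), THEN conjunct2] that(2)])
  \<comment> \<open>\<open>T v\<close> is \<open>X v\<close> as a function on the product space of the sources.\<close>
  define T where "T v = (\<lambda>z. f v (restrict z {i \<in> I. v \<in> W i}))" for v
  have T: "T v \<in> ?P \<rightarrow>\<^sub>M A" if "v \<in> V" for v
  proof -
    have "T v \<in> Pi\<^sub>M I S \<rightarrow>\<^sub>M A"
      unfolding T_def by (rule measurable_compose[OF measurable_restrict_subset f[OF that]]) auto
    then show ?thesis by (simp add: measurable_cong_sets[OF sets_P refl])
  qed
  have XT: "X v \<omega> = T v (Zs \<omega>)" if "v \<in> V" "\<omega> \<in> space M" for v \<omega>
  proof -
    have "restrict (Zs \<omega>) {i \<in> I. v \<in> W i} = (\<lambda>i\<in>{i \<in> I. v \<in> W i}. Z i \<omega>)"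
      by (auto simp: Zs_def fun_eq_iff)
    then show ?thesis using Xf[OF that] by (simp add: T_def)
  qed
  define TT where "TT e = (\<lambda>z. (T (fst (ends e)) z, T (snd (ends e)) z))" for e
  have TT: "TT e \<in> ?P \<rightarrow>\<^sub>M A \<Otimes>\<^sub>M A" if "e \<in> E" for e
    unfolding TT_def using endsV[OF that] by (intro measurable_Pair T)
  have law_v: "distr M A (X v) = distr ?P A (T v)" if "v \<in> V" for v
  proof -
    have "distr M A (X v) = distr M A (T v \<circ> Zs)"
      using that by (intro distr_cong refl) (simp add: XT)
    also have "\<dots> = distr (distr M ?P Zs) A (T v)" by (rule distr_distr[OF T[OF that] Zs', symmetric])
    finally show ?thesis by (simp add: distr_Zs)
  qed
  have law_e: "distr M (A \<Otimes>\<^sub>M A) (\<lambda>\<omega>. (X (fst (ends e)) \<omega>, X (snd (ends e)) \<omega>))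
      = distr ?P (A \<Otimes>\<^sub>M A) (TT e)" if "e \<in> E" for e
  proof -
    have "distr M (A \<Otimes>\<^sub>M A) (\<lambda>\<omega>. (X (fst (ends e)) \<omega>, X (snd (ends e)) \<omega>))
        = distr M (A \<Otimes>\<^sub>M A) (TT e \<circ> Zs)"
      using endsV[OF that] by (intro distr_cong refl) (simp add: XT TT_def)
    also have "\<dots> = distr (distr M ?P Zs) (A \<Otimes>\<^sub>M A) (TT e)"
      by (rule distr_distr[OF TT[OF that] Zs', symmetric])
    finally show ?thesis by (simp add: distr_Zs)
  qed
  define d where "d v k = Q.val A \<delta> (T v) {1..k}" for v k
  define D where "D e k = Q.val (A \<Otimes>\<^sub>M A) \<Delta> (TT e) {1..k}" for e k
  have step: "seed_expansion E m W * (\<Sum>v\<in>V. d v k - d v (Suc k)) \<le> (\<Sum>e\<in>E. D e k - D e (Suc k))"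
    if k: "k < m" for k
  proof (rule expansion_weighted[OF finV finE])
    have sub: "{1..k} \<subseteq> {1..Suc k}" by auto
    have Sk: "Suc k \<in> {1..m}" using k by simp
    show "seed_expansion E m W * card U \<le> card (incident_edges E U)"
      if "U \<subseteq> W (Suc k)" "U \<noteq> {}" for U
      using W finV by (intro seed_expansion_le[where W=W and i="Suc k", OF _ Sk that]) (rule finite_subset)
    show "0 \<le> d v k - d v (Suc k)" if "v \<in> V" for v
      using Q.uncertainty_cond_value_antimono[OF T[OF that] sub \<delta>] by (simp add: d_def)
    show "0 \<le> D e k - D e (Suc k)" if "e \<in> E" for e
      using Q.uncertainty_cond_value_antimono[OF TT[OF that] sub \<Delta>] by (simp add: D_def)
    show "d v k - d v (Suc k) = 0" if "v \<in> V - W (Suc k)" for v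
    proof -
      have "T v z = T v z'" if "\<And>j. j \<in> I - {Suc k} \<Longrightarrow> z j = z' j" for z z'
        unfolding T_def using that \<open>v \<in> V - W (Suc k)\<close>
        by (intro arg_cong[where f="f v"]) (auto simp: restrict_def fun_eq_iff)
      then have "Q.val A \<delta> (T v) (insert (Suc k) {1..k}) = Q.val A \<delta> (T v) {1..k}"
        by (rule Q.cond_value_irrelevant)
      then show ?thesis by (simp add: d_def atLeastAtMostSuc_conv)
    qed
    show "d v k - d v (Suc k) \<le> D e k - D e (Suc k)" if e: "e \<in> E" and v: "v \<in> e" for e v
    proof -
      have "v = fst (ends e) \<or> v = snd (ends e)" using ends[OF e] v by blast
      then show ?thesis
        using Q.cond_value_drop_mono[OF TT[OF e] measurable_fst sub \<Delta> \<delta> concave1]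
          Q.cond_value_drop_mono[OF TT[OF e] measurable_snd sub \<Delta> \<delta> concave2]
        by (auto simp: d_def D_def TT_def)
    qed
  qed
  have d0: "d v 0 = \<delta> (distr M A (X v))" if "v \<in> V" for v
    using that by (simp add: d_def Q.cond_value_empty law_v)
  have D0: "D e 0 = \<Delta> (distr M (A \<Otimes>\<^sub>M A) (\<lambda>\<omega>. (X (fst (ends e)) \<omega>, X (snd (ends e)) \<omega>)))"
    if "e \<in> E" for e
    using that by (simp add: D_def Q.cond_value_empty law_e)
  have dm: "d v m = 0" if "v \<in> V" for v
    using Q.cond_value_all[OF T[OF that] \<delta>] by (simp add: d_def I_def)
  have Dm: "D e m = 0" if "e \<in> E" for e
    using Q.cond_value_all[OF TT[OF that] \<Delta>] by (simp add: D_def I_def)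
  have "seed_expansion E m W * (\<Sum>v\<in>V. d v 0)
      = (\<Sum>k<m. seed_expansion E m W * (\<Sum>v\<in>V. d v k - d v (Suc k)))"
    by (simp add: sum_eq_sum_of_drops[where g=d, OF dm] sum_distrib_left)
  also have "\<dots> \<le> (\<Sum>k<m. \<Sum>e\<in>E. D e k - D e (Suc k))" by (intro sum_mono step) simp
  also have "\<dots> = (\<Sum>e\<in>E. D e 0)" by (simp add: sum_eq_sum_of_drops[where g=D, OF Dm])
  finally show ?thesis by (simp add: d0 D0)
qed

end
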